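(* Let $n\ge1$ be an integer and let $\alpha,\beta\in\mathbb R$ with $\alpha\ne-\frac1{2n}$ and $\beta\neq0$. Equip $\Xi_n$ with the (semi-)Riemannian metric $$g_{D,u}((X,x),(Y,y))=\frac12\operatorname{Tr}(D^{-1}XD^{-1}Y)+\alpha\operatorname{Tr}(D^{-1}X)\operatorname{Tr}(D^{-1}Y)+\beta\langle x,Dy\rangle.$$ For every $(D,u)\in\Xi_n$ and all tangent vectors $(X,x),(Y,y),(Z,z)\in\mathrm T_n$, the Riemann curvature tensor is $R_{(D,u)}((X,x),(Y,y),(Z,z))=(V,v)\in M_n\times\mathbb R^n$ with $$\begin{aligned}V={}&\tfrac14\left(ZD^{-1}XD^{-1}Y+YD^{-1}XD^{-1}Z-XD^{-1}YD^{-1}Z-ZD^{-1}YD^{-1}X\right)\\&+\tfrac\beta4\left((Yx)\odot(Dz)-(Xy)\odot(Dz)+(Dy)\odot(Zx)-(Dx)\odot(Zy)\right)\\&+\tfrac{\alpha\beta}{1+2n\alpha}\left(\langle Xy-Yx,z\rangle+\langle x,Zy\rangle-\langle y,Zx\rangle\right)D,\end{aligned}$$ $$\begin{aligned}v={}&\tfrac14\left(D^{-1}(YD^{-1}X-XD^{-1}Y)z+D^{-1}ZD^{-1}(Xy-Yx)\right)\\&+\tfrac\beta4\left((z\odot x)Dy-(z\odot y)Dx\right)+\tfrac{\alpha\beta}{1+2n\alpha}\left(\langle y,Dz\rangle x-\langle x,Dz\rangle y\right).\end{aligned}$$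
   Context: $\Xi_n=\mathcal M_n\times\mathbb R^n$, where $\mathcal M_n$ is the set of real symmetric strictly positive definite $n\times n$ matrices. $\Xi_n$ is an open subset of the vector space $\mathrm T_n=M_n\times\mathbb R^n$ ($M_n$ = real symmetric $n\times n$ matrices), so the tangent space at each point is $\mathrm T_n$. For $v,w\in\mathbb R^n$, $v\odot w$ is the symmetric $n\times n$ matrix with entries $(v\odot w)_{ij}=v_iw_j+v_jw_i$. Convention for curvature: let $\Gamma_{(D,u)}:\mathrm T_n\times\mathrm T_n\to\mathrm T_n$ be the symmetric bilinear map giving the Levi-Civita connection of $g$ in the global affine coordinates of $\mathrm T_n$ (so $\nabla_\xi\eta=d\eta(\xi)+\Gamma(\xi)(\eta)$), and let $d\Gamma_{(D,u)}(\xi)$ be its derivative in direction $\xi$. For $\xi,\eta,\zeta\in\mathrm T_n$, $$R_{(D,u)}(\xi,\eta,\zeta)=d\Gamma_{(D,u)}(\xi)(\eta)(\zeta)-d\Gamma_{(D,u)}(\eta)(\xi)(\zeta)+\Gamma_{(D,u)}(\xi,\Gamma_{(D,u)}(\eta)(\zeta))-\Gamma_{(D,u)}(\eta,\Gamma_{(D,u)}(\xi)(\zeta)),$$ i.e. $R(\xi,\eta,\zeta)=R(\xi,\eta)\zeta$ with $R(\xi,\eta)=[\nabla_\xi,\nabla_\eta]-\nabla_{[\xi,\eta]}$. *)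

theory Defs
  imports "HOL-Analysis.Analysis"
begin

section \<open>Metrics on relatively open subsets of a linear subspace\<close>

text \<open>
  Throughout, \<open>T\<close> is a linear subspace of a real normed space and \<open>U \<subseteq> T\<close> is open in \<open>T\<close>, so
  that \<open>T\<close> is the tangent space of \<open>U\<close> at each of its points. Derivatives at points of \<open>U\<close> are only
  taken in directions belonging to \<open>T\<close>.
\<close>

definition dir_deriv ::
    "('a::real_normed_vector \<Rightarrow> 'b::real_normed_vector) \<Rightarrow> 'a \<Rightarrow> 'a \<Rightarrow> 'b" where
  "dir_deriv f p \<xi> = vector_derivative (\<lambda>t::real. f (p + t *\<^sub>R \<xi>)) (at 0)"

definition vector_fields :: "'a::real_normed_vector set \<Rightarrow> 'a set \<Rightarrow> ('a \<Rightarrow> 'a) set" where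
  "vector_fields T U = {\<eta>. \<eta> ` U \<subseteq> T \<and> \<eta> differentiable_on U}"

definition lie_bracket ::
    "('a::real_normed_vector \<Rightarrow> 'a) \<Rightarrow> ('a \<Rightarrow> 'a) \<Rightarrow> 'a \<Rightarrow> 'a" where
  "lie_bracket \<xi> \<eta> p = dir_deriv \<eta> p (\<xi> p) - dir_deriv \<xi> p (\<eta> p)"

text \<open>The affine connection with Christoffel map \<open>\<Gamma>\<close> in the affine coordinates of \<open>T\<close>.\<close>

definition covariant_deriv ::
    "('a::real_normed_vector \<Rightarrow> 'a \<Rightarrow> 'a \<Rightarrow> 'a) \<Rightarrow> ('a \<Rightarrow> 'a) \<Rightarrow> ('a \<Rightarrow> 'a) \<Rightarrow> 'a \<Rightarrow> 'a" where
  "covariant_deriv \<Gamma> \<xi> \<eta> p = dir_deriv \<eta> p (\<xi> p) + \<Gamma> p (\<xi> p) (\<eta> p)"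

definition symmetric_bilinear_on ::
    "'a::real_vector set \<Rightarrow> ('a \<Rightarrow> 'a \<Rightarrow> 'a) \<Rightarrow> bool" where
  "symmetric_bilinear_on T B \<longleftrightarrow>
     (\<forall>x\<in>T. \<forall>y\<in>T. B x y \<in> T \<and> B x y = B y x) \<and>
     (\<forall>x\<in>T. \<forall>y\<in>T. \<forall>z\<in>T. B (x + y) z = B x z + B y z) \<and>
     (\<forall>c. \<forall>x\<in>T. \<forall>y\<in>T. B (c *\<^sub>R x) y = c *\<^sub>R B x y)"

definition is_levi_civita ::
    "'a::real_normed_vector set \<Rightarrow> 'a set \<Rightarrow> ('a \<Rightarrow> 'a \<Rightarrow> 'a \<Rightarrow> real) \<Rightarrow> ('a \<Rightarrow> 'a \<Rightarrow> 'a \<Rightarrow> 'a) \<Rightarrow> bool"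
  where
  "is_levi_civita T U g \<Gamma> \<longleftrightarrow>
     (\<forall>p\<in>U. symmetric_bilinear_on T (\<Gamma> p)) \<and>
     (\<forall>\<xi>\<in>vector_fields T U. \<forall>\<eta>\<in>vector_fields T U. \<forall>p\<in>U.
        covariant_deriv \<Gamma> \<xi> \<eta> p - covariant_deriv \<Gamma> \<eta> \<xi> p = lie_bracket \<xi> \<eta> p) \<and>
     (\<forall>\<xi>\<in>vector_fields T U. \<forall>\<eta>\<in>vector_fields T U. \<forall>\<zeta>\<in>vector_fields T U. \<forall>p\<in>U.
        dir_deriv (\<lambda>q. g q (\<eta> q) (\<zeta> q)) p (\<xi> p) =
          g p (covariant_deriv \<Gamma> \<xi> \<eta> p) (\<zeta> p) + g p (\<eta> p) (covariant_deriv \<Gamma> \<xi> \<zeta> p))"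

text \<open>
  The values of \<open>\<Gamma>\<close> at points outside \<open>U\<close> or on vectors outside \<open>T\<close> carry no meaning; they are set
  to \<open>0\<close> to make \<open>\<Gamma>\<close> unique as a total function.
\<close>

definition levi_civita ::
    "'a::real_normed_vector set \<Rightarrow> 'a set \<Rightarrow> ('a \<Rightarrow> 'a \<Rightarrow> 'a \<Rightarrow> real) \<Rightarrow> ('a \<Rightarrow> 'a \<Rightarrow> 'a \<Rightarrow> 'a)" where
  "levi_civita T U g =
     (THE \<Gamma>. is_levi_civita T U g \<Gamma> \<and>
        (\<forall>p \<xi> \<eta>. \<not> (p \<in> U \<and> \<xi> \<in> T \<and> \<eta> \<in> T) \<longrightarrow> \<Gamma> p \<xi> \<eta> = 0))"

text \<open>
  Sign convention: \<open>R(\<xi>, \<eta>) \<zeta>\<close> with \<open>R(\<xi>, \<eta>) = [\<nabla>\<^sub>\<xi>, \<nabla>\<^sub>\<eta>] - \<nabla>\<close> along \<open>[\<xi>, \<eta>]\<close>.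
\<close>

definition riemann_curvature ::
    "'a::real_normed_vector set \<Rightarrow> 'a set \<Rightarrow> ('a \<Rightarrow> 'a \<Rightarrow> 'a \<Rightarrow> real) \<Rightarrow> 'a \<Rightarrow> 'a \<Rightarrow> 'a \<Rightarrow> 'a \<Rightarrow> 'a" where
  "riemann_curvature T U g p \<xi> \<eta> \<zeta> =
     (let \<Gamma> = levi_civita T U g in
        dir_deriv (\<lambda>q. \<Gamma> q \<eta> \<zeta>) p \<xi> - dir_deriv (\<lambda>q. \<Gamma> q \<xi> \<zeta>) p \<eta>
        + \<Gamma> p \<xi> (\<Gamma> p \<eta> \<zeta>) - \<Gamma> p \<eta> (\<Gamma> p \<xi> \<zeta>))"


section \<open>Positive definite matrices paired with vectors\<close>

definition sym_mats :: "(real^'n^'n) set" where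
  "sym_mats = {A. transpose A = A}"

definition pos_def_mats :: "(real^'n^'n) set" where
  "pos_def_mats = {A \<in> sym_mats. \<forall>x. x \<noteq> 0 \<longrightarrow> x \<bullet> (A *v x) > 0}"

definition Tan :: "((real^'n^'n) \<times> (real^'n)) set" where
  "Tan = sym_mats \<times> UNIV"

definition Xi :: "((real^'n^'n) \<times> (real^'n)) set" where
  "Xi = pos_def_mats \<times> UNIV"

definition sym_prod :: "real^'n \<Rightarrow> real^'n \<Rightarrow> real^'n^'n" (infixl "\<odot>" 75) where
  "v \<odot> w = (\<chi> i j. v $ i * w $ j + v $ j * w $ i)"

definition Xi_metric :: "real \<Rightarrow> real \<Rightarrow> (real^'n^'n) \<times> (real^'n) \<Rightarrow>
    (real^'n^'n) \<times> (real^'n) \<Rightarrow> (real^'n^'n) \<times> (real^'n) \<Rightarrow> real" where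
  "Xi_metric \<alpha> \<beta> = (\<lambda>(D, u) (X, x) (Y, y).
     1/2 * trace (matrix_inv D ** X ** matrix_inv D ** Y)
     + \<alpha> * trace (matrix_inv D ** X) * trace (matrix_inv D ** Y)
     + \<beta> * (x \<bullet> (D *v y)))"

end

theory Submission
  imports Defs
begin

text \<open>
  Write \<open>P\<close> for the inverse of \<open>D\<close>. In direction \<open>X\<close> the inverse has derivative \<open>- P X P\<close>, so all terms
  of the Koszul formula are explicit, and it is solved by
  \<open>\<Gamma>((X, x), (Y, y)) = (- 1/2 (X P Y + Y P X) - \<beta>/2 (D x) \<odot> (D y) + 2 c \<langle>x, D y\<rangle> D, 1/2 P (X y + Y x))\<close>
  with \<open>c = \<alpha> \<beta> / (1 + 2 n \<alpha>)\<close>. Here \<open>- 1/2 (X P Y + Y P X)\<close> is the connection of the trace metric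
  on positive definite matrices, the symmetric product represents, up to a factor, the form
  \<open>\<langle>x, Z y\<rangle>\<close> in \<open>Z\<close>, and
  the multiple of \<open>D\<close> corrects the trace of that symmetric product against the \<open>\<alpha>\<close>-term.

  That \<open>\<Gamma>\<close> is torsion-free and bilinear is visible. Its compatibility with the metric combines a
  product rule along lines (\<open>Xi_metric_product_rule\<close>) with an identity between traces
  (\<open>Xi_metric_christoffel\<close>). It is the only such connection because the metric is nondegenerate on
  the tangent space, which is where \<open>\<alpha> \<noteq> - 1 / (2 n)\<close> and \<open>\<beta> \<noteq> 0\<close> come from
  (\<open>Xi_metric_nondegenerate\<close>, \<open>levi_civita_eqI\<close>).

  The curvature then follows by differentiating \<open>\<Gamma>\<close> once more and expanding. The one nontrivial
  simplification is that \<open>A (v \<odot> w)\<close> plus its transpose is \<open>(A v) \<odot> w + v \<odot> (A w)\<close>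
  (\<open>sym_prod_derivation\<close>).
\<close>

section \<open>Bilinearity of matrix operations\<close>

lemma bounded_bilinear_matrix_mult: "bounded_bilinear ((**) :: real^'n^'m \<Rightarrow> real^'k^'n \<Rightarrow> real^'k^'m)"
  by (auto simp: bilinear_conv_bounded_bilinear[symmetric] bilinear_def linear_iff vec_eq_iff
     matrix_matrix_mult_def sum.distrib sum_distrib_left algebra_simps)

lemma bounded_bilinear_matrix_vector: "bounded_bilinear ((*v) :: real^'n^'m \<Rightarrow> real^'n \<Rightarrow> real^'m)"
  by (auto simp: bilinear_conv_bounded_bilinear[symmetric] bilinear_def linear_iff vec_eq_iff
     matrix_vector_mult_def sum.distrib sum_distrib_left algebra_simps)

lemma bounded_bilinear_sym_prod: "bounded_bilinear ((\<odot>) :: real^'n \<Rightarrow> real^'n \<Rightarrow> real^'n^'n)"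
  by (auto simp: bilinear_conv_bounded_bilinear[symmetric] bilinear_def linear_iff vec_eq_iff
     sym_prod_def algebra_simps)

lemma bounded_linear_trace: "bounded_linear (trace :: real^'n^'n \<Rightarrow> real)"
  by (auto simp: linear_conv_bounded_linear[symmetric] linear_iff trace_def sum.distrib sum_distrib_left)

interpretation matmul: bounded_bilinear "(**) :: real^'n^'m \<Rightarrow> real^'k^'n \<Rightarrow> real^'k^'m"
  by (fact bounded_bilinear_matrix_mult)

interpretation matvec: bounded_bilinear "(*v) :: real^'n^'m \<Rightarrow> real^'n \<Rightarrow> real^'m"
  by (fact bounded_bilinear_matrix_vector)

interpretation symprod: bounded_bilinear "(\<odot>) :: real^'n \<Rightarrow> real^'n \<Rightarrow> real^'n^'n"
  by (fact bounded_bilinear_sym_prod)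

lemmas trace_minus = linear_neg[OF bounded_linear.linear[OF bounded_linear_trace]]
lemmas trace_scaleR = linear_scale[OF bounded_linear.linear[OF bounded_linear_trace]]

section \<open>Invertible and positive definite matrices\<close>

lemma matrix_inv_invertible:
  fixes A :: "real^'n^'n"
  assumes "invertible A"
  shows "matrix_inv A ** A = mat 1" "A ** matrix_inv A = mat 1"
proof -
  have "A ** matrix_inv A = mat 1 \<and> matrix_inv A ** A = mat 1"
    unfolding matrix_inv_def using assms unfolding invertible_def by (rule someI_ex)
  then show "matrix_inv A ** A = mat 1" "A ** matrix_inv A = mat 1"
    by simp_all
qed

lemma matrix_inv_cancel [simp]:
  fixes A :: "real^'n^'n" and C :: "real^'n^'k"
  assumes "invertible A"
  shows "C ** matrix_inv A ** A = C" "C ** A ** matrix_inv A = C"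
    "matrix_inv A *v (A *v v) = v" "A *v (matrix_inv A *v v) = v"
proof -
  show "C ** matrix_inv A ** A = C" "C ** A ** matrix_inv A = C"
    by (simp_all add: matrix_inv_invertible[OF assms] flip: matrix_mul_assoc)
  show "matrix_inv A *v (A *v v) = v" "A *v (matrix_inv A *v v) = v"
    by (simp_all add: matrix_vector_mul_assoc matrix_inv_invertible[OF assms])
qed

lemma transpose_matrix_inv:
  fixes A :: "real^'n^'n"
  assumes "invertible A" "transpose A = A"
  shows "transpose (matrix_inv A) = matrix_inv A"
proof -
  have "transpose (matrix_inv A) ** A = mat 1"
    using arg_cong[OF matrix_inv_invertible(2)[OF assms(1)], of transpose]
    by (simp add: matrix_transpose_mul assms)
  then have "transpose (matrix_inv A) ** A ** matrix_inv A = matrix_inv A"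
    by simp
  then show ?thesis
    using assms by simp
qed

lemma pos_def_mats_invertible:
  fixes D :: "real^'n^'n"
  assumes "D \<in> pos_def_mats"
  shows "invertible D"
proof -
  have "x = 0" if "D *v x = 0" for x
    using assms that by (force simp: pos_def_mats_def)
  then show ?thesis
    using matrix_left_invertible_ker[of D] invertible_left_inverse[of D] by blast
qed

text \<open>
  A positive definite form is bounded below by some \<open>c > 0\<close> on the compact unit sphere and the form
  of \<open>X\<close> is bounded there by some \<open>K\<close>, so positivity survives for \<open>\<bar>t\<bar> < c / K\<close>.
\<close>
lemma eventually_pos_def_mats:
  fixes D X :: "real^'n^'n"
  assumes D: "D \<in> pos_def_mats" and X: "X \<in> sym_mats"
  shows "\<forall>\<^sub>F t in nhds 0. D + t *\<^sub>R X \<in> pos_def_mats"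
proof -
  let ?S = "sphere (0 :: real^'n) 1"
  have ne: "?S \<noteq> {}"
    by simp
  have cont: "continuous_on ?S (\<lambda>x. x \<bullet> (A *v x))" for A :: "real^'n^'n"
    by (intro continuous_intros matvec.continuous_on)
  obtain a where a: "a \<in> ?S" "\<And>x. x \<in> ?S \<Longrightarrow> a \<bullet> (D *v a) \<le> x \<bullet> (D *v x)"
    using continuous_attains_inf[OF compact_sphere ne cont[of D]] by blast
  define c where "c = a \<bullet> (D *v a)"
  have "c > 0"
  proof -
    have "a \<noteq> 0"
      using a(1) by auto
    then show ?thesis
      using D by (simp add: pos_def_mats_def c_def)
  qed
  have "bounded ((\<lambda>x. x \<bullet> (X *v x)) ` ?S)"
    by (intro compact_imp_bounded compact_continuous_image cont compact_sphere)
  then obtain K where K: "K > 0" "\<And>x. x \<in> ?S \<Longrightarrow> \<bar>x \<bullet> (X *v x)\<bar> \<le> K"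
    unfolding bounded_pos by auto
  have pd: "D + t *\<^sub>R X \<in> pos_def_mats" if t: "\<bar>t\<bar> < c / K" for t
  proof -
    have tr: "transpose (D + t *\<^sub>R X) = D + t *\<^sub>R X"
      using D X by (simp add: pos_def_mats_def sym_mats_def transpose_def vec_eq_iff)
    have pos: "x \<bullet> ((D + t *\<^sub>R X) *v x) > 0" if "x \<noteq> 0" for x
    proof -
      let ?y = "x /\<^sub>R norm x"
      have y: "?y \<in> ?S"
        using that by simp
      have "\<bar>t * (?y \<bullet> (X *v ?y))\<bar> \<le> \<bar>t\<bar> * K"
        using K(2)[OF y] by (auto simp: abs_mult intro: mult_left_mono)
      also have "\<dots> < c"
        using t K(1) by (simp add: pos_less_divide_eq)
      also have "c \<le> ?y \<bullet> (D *v ?y)"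
        using a(2)[OF y] by (simp add: c_def)
      finally have "0 < ?y \<bullet> ((D + t *\<^sub>R X) *v ?y)"
        by (simp add: matvec.add_left matvec.scaleR_left inner_add_right)
      also have "\<dots> = (x \<bullet> ((D + t *\<^sub>R X) *v x)) / (norm x)\<^sup>2"
        by (simp add: matvec.scaleR_right power2_eq_square divide_inverse mult_ac)
      finally show ?thesis
        using that by (simp add: zero_less_divide_iff)
    qed
    show ?thesis
      using tr pos by (simp add: pos_def_mats_def sym_mats_def)
  qed
  have "c / K > 0"
    using \<open>c > 0\<close> K(1) by simp
  with pd show ?thesis
    unfolding eventually_nhds_metric by (auto simp: dist_real_def)
qed

text \<open>
  Writing \<open>P t\<close> for the inverse of \<open>D + t X\<close>, the resolvent identity
  \<open>P t - P 0 = - t (P t X P 0)\<close> holds as long as the determinant does not vanish. It bounds the norm of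
  \<open>P t\<close> by twice the norm of \<open>P 0\<close> for small \<open>t\<close>, which gives continuity at \<open>0\<close>; dividing the identity by
  \<open>t\<close> then gives the derivative.
\<close>
lemma matrix_inv_has_vector_derivative:
  fixes D X :: "real^'n^'n"
  assumes inv: "invertible D"
  shows "((\<lambda>t. matrix_inv (D + t *\<^sub>R X)) has_vector_derivative
    - (matrix_inv D ** X ** matrix_inv D)) (at 0)"
proof -
  define P where "P = (\<lambda>t. matrix_inv (D + t *\<^sub>R X))"
  have "((\<lambda>t. det (D + t *\<^sub>R X)) \<longlongrightarrow> det (D + 0 *\<^sub>R X)) (at 0)"
    unfolding det_def by (intro tendsto_intros)
  then have "\<forall>\<^sub>F t in at 0. det (D + t *\<^sub>R X) \<noteq> 0"
    using inv by (intro tendsto_imp_eventually_ne) (auto simp: invertible_det_nz)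
  then have ev: "\<forall>\<^sub>F t in at 0. P t - P 0 = - t *\<^sub>R (P t ** X ** P 0)"
  proof eventually_elim
    case (elim t)
    then have "invertible (D + t *\<^sub>R X)"
      by (simp add: invertible_det_nz)
    then have "P t ** (D + t *\<^sub>R X) ** P 0 = P 0"
      by (simp add: P_def matrix_inv_invertible)
    moreover have "P t ** (D + t *\<^sub>R X) ** P 0 = P t + t *\<^sub>R (P t ** X ** P 0)"
      using inv by (simp add: P_def matmul.add_left matmul.add_right matmul.scaleR_left matmul.scaleR_right)
    ultimately show ?case
      by (simp add: algebra_simps)
  qed
  obtain K where K: "K > 0" "\<And>(A::real^'n^'n) (B::real^'n^'n). norm (A ** B) \<le> norm A * norm B * K"
    using matmul.pos_bounded by blast
  define d where "d = K * norm (X ** P 0)"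
  have d0: "d \<ge> 0" using K by (simp add: d_def)
  have "((\<lambda>t. \<bar>t\<bar> * d) \<longlongrightarrow> \<bar>0\<bar> * d) (at 0)"
    by (intro tendsto_intros)
  then have small: "\<forall>\<^sub>F t in at 0. \<bar>t\<bar> * d < 1/2"
    by (rule order_tendstoD) simp
  have lim: "((\<lambda>t. P t - P 0) \<longlongrightarrow> 0) (at 0)"
  proof (rule Lim_null_comparison)
    show "\<forall>\<^sub>F t in at 0. norm (P t - P 0) \<le> \<bar>t\<bar> * d * (2 * norm (P 0))"
      using ev small
    proof eventually_elim
      case (elim t)
      have "norm (P t ** X ** P 0) \<le> norm (P t) * d"
        using K(2)[of "P t" "X ** P 0"] by (simp add: d_def matrix_mul_assoc mult_ac)
      then have *: "norm (P t - P 0) \<le> \<bar>t\<bar> * d * norm (P t)"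
        using elim by (simp add: mult.assoc mult_left_mono mult.commute[of d])
      also have "\<dots> \<le> 1/2 * norm (P t)"
        using elim by (intro mult_right_mono) auto
      finally have "norm (P t) \<le> 2 * norm (P 0)"
        using norm_triangle_ineq2[of "P t" "P 0"] by linarith
      then have "\<bar>t\<bar> * d * norm (P t) \<le> \<bar>t\<bar> * d * (2 * norm (P 0))"
        using d0 by (intro mult_left_mono) auto
      with * show ?case
        by linarith
    qed
    have "((\<lambda>t. \<bar>t\<bar> * d * (2 * norm (P 0))) \<longlongrightarrow> \<bar>0\<bar> * d * (2 * norm (P 0))) (at 0)"
      by (intro tendsto_intros)
    then show "((\<lambda>t. \<bar>t\<bar> * d * (2 * norm (P 0))) \<longlongrightarrow> 0) (at 0)"
      by simp
  qed
  then have "(P \<longlongrightarrow> P 0) (at 0)"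
    by (simp add: LIM_zero_iff)
  then have "((\<lambda>t. - (P t ** X ** P 0)) \<longlongrightarrow> - (P 0 ** X ** P 0)) (at 0)"
    by (intro tendsto_intros matmul.tendsto)
  then have "((\<lambda>t. (P t - P 0) /\<^sub>R t) \<longlongrightarrow> - (P 0 ** X ** P 0)) (at 0)"
  proof (rule Lim_transform_eventually)
    show "\<forall>\<^sub>F t in at 0. - (P t ** X ** P 0) = (P t - P 0) /\<^sub>R t"
      using ev eventually_neq_at_within[of 0]
      by eventually_elim simp
  qed
  then have "((\<lambda>t. norm ((P t - P 0) /\<^sub>R t - - (P 0 ** X ** P 0))) \<longlongrightarrow> 0) (at 0)"
    by (intro tendsto_norm_zero LIM_zero)
  then have "((\<lambda>t. norm (P (0 + t) - P 0 - t *\<^sub>R - (P 0 ** X ** P 0)) / norm t) \<longlongrightarrow> 0) (at 0)"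
  proof (rule Lim_transform_eventually)
    show "\<forall>\<^sub>F t in at 0. norm ((P t - P 0) /\<^sub>R t - - (P 0 ** X ** P 0)) =
        norm (P (0 + t) - P 0 - t *\<^sub>R - (P 0 ** X ** P 0)) / norm t"
      using eventually_neq_at_within[of 0]
    proof eventually_elim
      case (elim t)
      then have "(P t - P 0) /\<^sub>R t - - (P 0 ** X ** P 0) = (P t - P 0 - t *\<^sub>R - (P 0 ** X ** P 0)) /\<^sub>R t"
        by (simp add: algebra_simps)
      then show ?case
        by (simp add: divide_inverse_commute)
    qed
  qed
  then have "(P has_vector_derivative - (P 0 ** X ** P 0)) (at 0)"
    unfolding has_vector_derivative_def has_derivative_at
    by (intro conjI bounded_linear_scaleR_left)
  then show ?thesis
    by (simp add: P_def)
qed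

section \<open>Uniqueness of the Levi-Civita connection\<close>

text \<open>
  \<open>U\<close> has no interior in the ambient space when \<open>T\<close> is a proper subspace, so a field on \<open>U\<close> is only
  differentiable within \<open>U\<close>. This suffices along a line that stays in \<open>U\<close> for small times.
\<close>
lemma has_vector_derivative_along_line:
  fixes \<eta> :: "'a::real_normed_vector \<Rightarrow> 'b::real_normed_vector"
  assumes "\<eta> differentiable_on U" "p \<in> U" "\<forall>\<^sub>F t in nhds 0. p + t *\<^sub>R \<xi> \<in> U"
  shows "((\<lambda>t. \<eta> (p + t *\<^sub>R \<xi>)) has_vector_derivative dir_deriv \<eta> p \<xi>) (at 0)"
proof -
  obtain S where S: "open S" "(0::real) \<in> S" "\<And>t. t \<in> S \<Longrightarrow> p + t *\<^sub>R \<xi> \<in> U"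
    using assms(3) by (auto simp: eventually_nhds)
  obtain L where L: "(\<eta> has_derivative L) (at p within U)"
    using assms by (auto simp: differentiable_on_def differentiable_def)
  have line: "((\<lambda>t. p + t *\<^sub>R \<xi>) has_derivative (\<lambda>t. t *\<^sub>R \<xi>)) (at 0 within S)"
    by (auto intro!: derivative_eq_intros)
  have "(\<eta> has_derivative L) (at (p + 0 *\<^sub>R \<xi>) within (\<lambda>t. p + t *\<^sub>R \<xi>) ` S)"
    using L S(3) by (auto intro: has_derivative_subset)
  from has_derivative_in_compose[OF line this]
  have "(\<lambda>t. \<eta> (p + t *\<^sub>R \<xi>)) differentiable at 0"
    unfolding at_within_open[OF S(2,1)] by (rule differentiableI)
  then show ?thesis
    unfolding dir_deriv_def by (simp add: vector_derivative_works)
qed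

lemma dir_deriv_eqI:
  assumes "((\<lambda>t. f (p + t *\<^sub>R \<xi>)) has_vector_derivative d) (at 0)"
  shows "dir_deriv f p \<xi> = d"
  using vector_derivative_at[OF assms] by (simp add: dir_deriv_def)

lemma const_in_vector_fields: "c \<in> T \<Longrightarrow> (\<lambda>_. c) \<in> vector_fields T U"
  by (auto simp: vector_fields_def)

text \<open>
  Evaluated on constant fields, metric compatibility says that the difference \<open>s a b c\<close> of the two
  connections, lowered with \<open>g\<close>, is antisymmetric in its last two arguments, and the symmetry of
  Christoffel maps says that it is symmetric in its first two. Both together force it to vanish.
\<close>
lemma is_levi_civita_unique:
  assumes \<Gamma>: "is_levi_civita T U g \<Gamma>" and \<Gamma>': "is_levi_civita T U g \<Gamma>'"
    and sym: "\<And>v w. v \<in> T \<Longrightarrow> w \<in> T \<Longrightarrow> g p v w = g p w v"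
    and nondeg: "\<And>v w. v \<in> T \<Longrightarrow> w \<in> T \<Longrightarrow> (\<And>\<zeta>. \<zeta> \<in> T \<Longrightarrow> g p v \<zeta> = g p w \<zeta>) \<Longrightarrow> v = w"
    and p: "p \<in> U" and \<xi>: "\<xi> \<in> T" and \<eta>: "\<eta> \<in> T"
  shows "\<Gamma> p \<xi> \<eta> = \<Gamma>' p \<xi> \<eta>"
proof -
  have metric: "dir_deriv (\<lambda>q. g q \<eta> \<zeta>) p \<xi> = g p (G p \<xi> \<eta>) \<zeta> + g p (G p \<xi> \<zeta>) \<eta>"
    and symG: "G p \<xi> \<eta> = G p \<eta> \<xi>" and GT: "G p \<xi> \<eta> \<in> T"
    if G: "is_levi_civita T U g G" and T: "\<xi> \<in> T" "\<eta> \<in> T" "\<zeta> \<in> T" for G \<xi> \<eta> \<zeta>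
  proof -
    have bil: "symmetric_bilinear_on T (G p)"
      using G p by (simp add: is_levi_civita_def)
    then show "G p \<xi> \<eta> = G p \<eta> \<xi>" "G p \<xi> \<eta> \<in> T"
      using T by (auto simp: symmetric_bilinear_on_def)
    have cov: "covariant_deriv G (\<lambda>_. a) (\<lambda>_. b) p = G p a b" for a b
      by (simp add: covariant_deriv_def dir_deriv_def)
    have "G p \<xi> \<zeta> \<in> T"
      using bil T by (auto simp: symmetric_bilinear_on_def)
    then have "g p \<eta> (G p \<xi> \<zeta>) = g p (G p \<xi> \<zeta>) \<eta>"
      using T sym by blast
    moreover
    have "\<forall>\<xi>\<in>vector_fields T U. \<forall>\<eta>\<in>vector_fields T U. \<forall>\<zeta>\<in>vector_fields T U. \<forall>p\<in>U.
        dir_deriv (\<lambda>q. g q (\<eta> q) (\<zeta> q)) p (\<xi> p) =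
          g p (covariant_deriv G \<xi> \<eta> p) (\<zeta> p) + g p (\<eta> p) (covariant_deriv G \<xi> \<zeta> p)"
      using conjunct2[OF conjunct2[OF G[unfolded is_levi_civita_def]]] .
    note this[rule_format, OF T[THEN const_in_vector_fields] p]
    ultimately show "dir_deriv (\<lambda>q. g q \<eta> \<zeta>) p \<xi> = g p (G p \<xi> \<eta>) \<zeta> + g p (G p \<xi> \<zeta>) \<eta>"
      by (simp add: cov)
  qed
  define s where "s a b c = g p (\<Gamma> p a b) c - g p (\<Gamma>' p a b) c" for a b c
  have alt: "s a b c = - s a c b" if "a \<in> T" "b \<in> T" "c \<in> T" for a b c
    using metric[OF \<Gamma> that] metric[OF \<Gamma>' that] by (simp add: s_def)
  have com: "s a b c = s b a c" if "a \<in> T" "b \<in> T" "c \<in> T" for a b c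
    using symG[OF \<Gamma> that] symG[OF \<Gamma>' that] by (simp add: s_def)
  \<comment> \<open>Swapping the last two and the first two arguments alternately, three times each, returns to the
    starting point with sign \<open>-1\<close>.\<close>
  have "s \<xi> \<eta> c = 0" if "c \<in> T" for c
    using alt[OF \<xi> \<eta> that] com[OF \<xi> that \<eta>] alt[OF that \<xi> \<eta>] com[OF that \<eta> \<xi>]
      alt[OF \<eta> that \<xi>] com[OF \<eta> \<xi> that] by linarith
  then show ?thesis
    using GT[OF \<Gamma> \<xi> \<eta> \<eta>] GT[OF \<Gamma>' \<xi> \<eta> \<eta>] by (intro nondeg) (auto simp: s_def)
qed

text \<open>
  Vector fields map \<open>U\<close> into \<open>T\<close>, so the defining conditions see \<open>\<Gamma>\<close> only on \<open>U\<close> and \<open>T\<close>. A closed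
  formula for a connection can hence be used without cutting it off to \<open>0\<close> elsewhere.
\<close>
lemma is_levi_civita_cong:
  assumes \<Gamma>: "is_levi_civita T U g \<Gamma>" and T: "subspace T"
    and eq: "\<And>p \<xi> \<eta>. p \<in> U \<Longrightarrow> \<xi> \<in> T \<Longrightarrow> \<eta> \<in> T \<Longrightarrow> \<Gamma>' p \<xi> \<eta> = \<Gamma> p \<xi> \<eta>"
  shows "is_levi_civita T U g \<Gamma>'"
proof -
  have cov: "covariant_deriv \<Gamma>' \<xi> \<eta> p = covariant_deriv \<Gamma> \<xi> \<eta> p"
    if "\<xi> \<in> vector_fields T U" "\<eta> \<in> vector_fields T U" "p \<in> U" for \<xi> \<eta> p
    using that by (auto simp: covariant_deriv_def vector_fields_def intro!: eq)
  have "symmetric_bilinear_on T (\<Gamma>' p)" if "p \<in> U" for p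
  proof -
    have "symmetric_bilinear_on T (\<Gamma>' p) \<longleftrightarrow> symmetric_bilinear_on T (\<Gamma> p)"
      unfolding symmetric_bilinear_on_def
      using eq[OF that] subspace_add[OF T] subspace_scale[OF T] by simp
    then show ?thesis
      using \<Gamma> that by (simp add: is_levi_civita_def)
  qed
  then show ?thesis
    using \<Gamma> by (simp add: is_levi_civita_def cov)
qed

lemma levi_civita_eqI:
  assumes \<Gamma>: "is_levi_civita T U g \<Gamma>" and T: "subspace T"
    and sym: "\<And>p v w. p \<in> U \<Longrightarrow> v \<in> T \<Longrightarrow> w \<in> T \<Longrightarrow> g p v w = g p w v"
    and nondeg: "\<And>p v w. p \<in> U \<Longrightarrow> v \<in> T \<Longrightarrow> w \<in> T \<Longrightarrow>
      (\<And>\<zeta>. \<zeta> \<in> T \<Longrightarrow> g p v \<zeta> = g p w \<zeta>) \<Longrightarrow> v = w"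
    and "p \<in> U" "\<xi> \<in> T" "\<eta> \<in> T"
  shows "levi_civita T U g p \<xi> \<eta> = \<Gamma> p \<xi> \<eta>"
proof -
  define \<Gamma>' where "\<Gamma>' = (\<lambda>p \<xi> \<eta>. if p \<in> U \<and> \<xi> \<in> T \<and> \<eta> \<in> T then \<Gamma> p \<xi> \<eta> else 0)"
  have lc: "is_levi_civita T U g \<Gamma>'"
    by (rule is_levi_civita_cong[OF \<Gamma> T]) (simp add: \<Gamma>'_def)
  have "levi_civita T U g = \<Gamma>'"
    unfolding levi_civita_def
  proof (rule the_equality)
    show "is_levi_civita T U g \<Gamma>' \<and>
        (\<forall>p \<xi> \<eta>. \<not> (p \<in> U \<and> \<xi> \<in> T \<and> \<eta> \<in> T) \<longrightarrow> \<Gamma>' p \<xi> \<eta> = 0)"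
      using lc by (auto simp: \<Gamma>'_def)
    fix G assume G: "is_levi_civita T U g G \<and>
        (\<forall>p \<xi> \<eta>. \<not> (p \<in> U \<and> \<xi> \<in> T \<and> \<eta> \<in> T) \<longrightarrow> G p \<xi> \<eta> = 0)"
    show "G = \<Gamma>'"
    proof (intro ext)
      fix p \<xi> \<eta>
      show "G p \<xi> \<eta> = \<Gamma>' p \<xi> \<eta>"
      proof (cases "p \<in> U \<and> \<xi> \<in> T \<and> \<eta> \<in> T")
        case True
        then show ?thesis
          using is_levi_civita_unique[of T U g G \<Gamma>' p \<xi> \<eta>] G lc sym nondeg by blast
      next
        case False
        then show ?thesis
          using G by (auto simp: \<Gamma>'_def)
      qed
    qed
  qed
  then show ?thesis
    using assms by (simp add: \<Gamma>'_def)
qed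

section \<open>The symmetric product of two vectors\<close>

lemma inner_symmetric_matrix:
  fixes A :: "real^'n^'n"
  assumes "transpose A = A"
  shows "x \<bullet> (A *v y) = (A *v x) \<bullet> y"
  using dot_lmul_matrix[of x A y] transpose_matrix_vector[of A x] assms by simp

lemma sym_prod_commute: "v \<odot> w = w \<odot> v"
  by (simp add: sym_prod_def vec_eq_iff algebra_simps)

lemma transpose_sym_prod: "transpose (v \<odot> w) = v \<odot> w"
  by (simp add: sym_prod_def transpose_def vec_eq_iff algebra_simps)

lemma sym_prod_mult_vector: "(v \<odot> w) *v x = (w \<bullet> x) *\<^sub>R v + (v \<bullet> x) *\<^sub>R w"
  by (simp add: sym_prod_def matrix_vector_mult_def inner_vec_def vec_eq_iff sum.distrib
      sum_distrib_left sum_distrib_right algebra_simps)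

lemma trace_sym_prod_mult: "trace ((v \<odot> w) ** A) = v \<bullet> (A *v w) + w \<bullet> (A *v v)"
proof -
  have "trace ((v \<odot> w) ** A) = (\<Sum>i\<in>UNIV. \<Sum>k\<in>UNIV. v $ i * w $ k * A $ k $ i)
      + (\<Sum>i\<in>UNIV. \<Sum>k\<in>UNIV. v $ k * w $ i * A $ k $ i)"
    by (simp add: trace_def sym_prod_def matrix_matrix_mult_def sum.distrib algebra_simps)
  also have "(\<Sum>i\<in>UNIV. \<Sum>k\<in>UNIV. v $ i * w $ k * A $ k $ i) = w \<bullet> (A *v v)"
    by (subst sum.swap) (simp add: inner_vec_def matrix_vector_mult_def sum_distrib_left mult_ac)
  also have "(\<Sum>i\<in>UNIV. \<Sum>k\<in>UNIV. v $ k * w $ i * A $ k $ i) = v \<bullet> (A *v w)"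
    by (subst sum.swap) (simp add: inner_vec_def matrix_vector_mult_def sum_distrib_left mult_ac)
  finally show ?thesis by simp
qed

text \<open>
  As a sum of two matrices of rank one, \<open>v \<odot> w\<close> can be moved through products with \<open>A\<close> on the left
  and the transpose of \<open>A\<close> on the right: each factor only hits one of the vectors.
\<close>
lemma sym_prod_eq_rank_one:
  "v \<odot> w = (columnvector v :: real^1^'n) ** rowvector w + (columnvector w :: real^1^'n) ** rowvector v"
  by (simp add: sym_prod_def columnvector_def rowvector_def matrix_matrix_mult_def vec_eq_iff)

lemma matrix_mult_rank_one:
  fixes A :: "real^'n^'k" and v :: "real^'n" and w :: "real^'m"
  shows "A ** ((columnvector v :: real^1^'n) ** (rowvector w :: real^'m^1)) =
    (columnvector (A *v v) :: real^1^'k) ** rowvector w"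
proof -
  have "A ** (columnvector v :: real^1^'n) = columnvector (A *v v)"
    by (simp add: columnvector_def matrix_matrix_mult_def matrix_vector_mult_def vec_eq_iff)
  then show ?thesis
    by (simp add: matrix_mul_assoc)
qed

lemma rank_one_mult_transpose:
  fixes B :: "real^'n^'k" and v :: "real^'m" and w :: "real^'n"
  shows "((columnvector v :: real^1^'m) ** (rowvector w :: real^'n^1)) ** transpose B =
    (columnvector v :: real^1^'m) ** rowvector (B *v w)"
proof -
  have "(rowvector w :: real^'n^1) ** transpose B = rowvector (B *v w)"
    by (simp add: rowvector_def transpose_def matrix_matrix_mult_def matrix_vector_mult_def
        vec_eq_iff mult.commute)
  then show ?thesis
    by (simp flip: matrix_mul_assoc)
qed

lemma sym_prod_congruence: "A ** (v \<odot> w) ** transpose A = (A *v v) \<odot> (A *v w)"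
  by (simp add: sym_prod_eq_rank_one matmul.add_left matmul.add_right
      matrix_mult_rank_one rank_one_mult_transpose)

text \<open>
  The infinitesimal version of the congruence rule. In the curvature the products of
  \<open>X ** matrix_inv D\<close> with a symmetric product occur in exactly this combination.
\<close>
lemma sym_prod_derivation:
  "A ** (v \<odot> w) + (v \<odot> w) ** transpose A = (A *v v) \<odot> w + v \<odot> (A *v w)"
  by (simp add: sym_prod_eq_rank_one matmul.add_left matmul.add_right
      matrix_mult_rank_one rank_one_mult_transpose)

section \<open>The metric and its Christoffel map\<close>

text \<open>
  The solution of the Koszul formula. For the parameters \<open>\<alpha>\<close>, \<open>\<beta>\<close> of the metric, \<open>c\<close> has to be
  \<open>\<alpha> * \<beta> / (1 + 2 * n * \<alpha>)\<close>: the multiple of \<open>D\<close> is there to cancel the product of traces that the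
  symmetric product \<open>(D *v x) \<odot> (D *v y)\<close> contributes when \<open>\<alpha> \<noteq> 0\<close>. Keeping \<open>c\<close> as an independent
  parameter leaves all identities below polynomial in the coefficients.
\<close>
definition Xi_christoffel :: "real \<Rightarrow> real \<Rightarrow> (real^'n^'n) \<times> (real^'n) \<Rightarrow>
    (real^'n^'n) \<times> (real^'n) \<Rightarrow> (real^'n^'n) \<times> (real^'n) \<Rightarrow> (real^'n^'n) \<times> (real^'n)" where
  "Xi_christoffel \<beta> c = (\<lambda>(D, u) (X, x) (Y, y).
     (- (1/2) *\<^sub>R (X ** matrix_inv D ** Y + Y ** matrix_inv D ** X)
      - (\<beta>/2) *\<^sub>R ((D *v x) \<odot> (D *v y)) + (2 * c * (x \<bullet> (D *v y))) *\<^sub>R D,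
      (1/2) *\<^sub>R (matrix_inv D *v (X *v y + Y *v x))))"

lemma subspace_Tan: "subspace Tan"
  by (auto simp: subspace_def Tan_def sym_mats_def transpose_def vec_eq_iff zero_prod_def)

lemma Xi_matrix_props:
  assumes "(D, u) \<in> Xi"
  shows "invertible D" "transpose D = D" "transpose (matrix_inv D) = matrix_inv D"
  using assms pos_def_mats_invertible[of D] transpose_matrix_inv[of D]
  by (auto simp: Xi_def pos_def_mats_def sym_mats_def)

lemma eventually_Xi:
  assumes "p \<in> Xi" "\<xi> \<in> Tan"
  shows "\<forall>\<^sub>F t in nhds 0. p + t *\<^sub>R \<xi> \<in> Xi"
  using assms eventually_pos_def_mats[of "fst p" "fst \<xi>"]
  by (auto simp: Xi_def Tan_def mem_Times_iff)

lemma transpose_add: "transpose (A + B) = transpose A + transpose (B :: real^'n^'m)"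
  and transpose_diff: "transpose (A - B) = transpose A - transpose (B :: real^'n^'m)"
  and transpose_minus: "transpose (- A) = - transpose (A :: real^'n^'m)"
  by (simp_all add: transpose_def vec_eq_iff)

lemma Xi_christoffel_in_Tan:
  assumes "p \<in> Xi" "\<xi> \<in> Tan" "\<eta> \<in> Tan"
  shows "Xi_christoffel \<beta> c p \<xi> \<eta> \<in> Tan"
proof -
  obtain D u X x Y y where "p = (D, u)" "\<xi> = (X, x)" "\<eta> = (Y, y)"
    by (metis surj_pair)
  then show ?thesis
    using assms Xi_matrix_props[of D u]
    by (simp add: Xi_christoffel_def Tan_def sym_mats_def transpose_add transpose_diff
        transpose_minus transpose_scalar matrix_transpose_mul transpose_sym_prod matrix_mul_assoc add.commute)
qed

lemma Xi_metric_commute: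
  assumes "p \<in> Xi"
  shows "Xi_metric \<alpha> \<beta> p \<xi> \<eta> = Xi_metric \<alpha> \<beta> p \<eta> \<xi>"
proof -
  obtain D u X x Y y where *: "p = (D, u)" "\<xi> = (X, x)" "\<eta> = (Y, y)"
    by (metis surj_pair)
  let ?P = "matrix_inv D"
  have "trace (?P ** X ** ?P ** Y) = trace (?P ** Y ** ?P ** X)"
    using trace_mul_sym[of "?P ** X" "?P ** Y"] by (simp add: matrix_mul_assoc)
  then show ?thesis
    using assms * Xi_matrix_props[of D u] inner_symmetric_matrix[of D x y]
    by (simp add: Xi_metric_def inner_commute)
qed

lemma Xi_metric_diff_left:
  "Xi_metric \<alpha> \<beta> p (\<xi> - \<eta>) \<zeta> = Xi_metric \<alpha> \<beta> p \<xi> \<zeta> - Xi_metric \<alpha> \<beta> p \<eta> \<zeta>"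
  by (simp add: Xi_metric_def case_prod_unfold matmul.diff_left matmul.diff_right trace_sub
      inner_diff_left field_simps)

lemma Xi_metric_add_left:
  "Xi_metric \<alpha> \<beta> p (\<xi> + \<eta>) \<zeta> = Xi_metric \<alpha> \<beta> p \<xi> \<zeta> + Xi_metric \<alpha> \<beta> p \<eta> \<zeta>"
  by (simp add: Xi_metric_def case_prod_unfold matmul.add_left matmul.add_right trace_add
      inner_add_left field_simps)

lemma trace_mult_transpose_eq_0:
  fixes A :: "real^'n^'n"
  assumes "trace (A ** transpose A) = 0"
  shows "A = 0"
proof -
  have "trace (A ** transpose A) = A \<bullet> A"
    by (simp add: trace_def matrix_matrix_mult_def transpose_def inner_vec_def)
  with assms show ?thesis by simp
qed

text \<open>
  Testing against \<open>(0, x)\<close> kills the vector part, since \<open>D\<close> is definite. Testing against \<open>(D, 0)\<close>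
  gives \<open>(1 + 2 n \<alpha>) Tr(P X) = 0\<close> for the inverse \<open>P\<close> of \<open>D\<close>, so the trace vanishes; testing against
  \<open>(P X P, 0)\<close> then gives the squared Frobenius norm of \<open>P X P\<close>.
\<close>
lemma Xi_metric_nondegenerate:
  fixes \<alpha> \<beta> :: real and p :: "(real^'n^'n) \<times> (real^'n)"
  assumes \<alpha>: "\<alpha> \<noteq> - 1 / (2 * real CARD('n))" and \<beta>: "\<beta> \<noteq> 0"
    and p: "p \<in> Xi" and \<xi>: "\<xi> \<in> Tan"
    and zero: "\<And>\<zeta>. \<zeta> \<in> Tan \<Longrightarrow> Xi_metric \<alpha> \<beta> p \<xi> \<zeta> = 0"
  shows "\<xi> = 0"
proof -
  obtain D u X x where *: "p = (D, u)" "\<xi> = (X, x)"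
    by (metis surj_pair)
  let ?P = "matrix_inv D"
  note D = Xi_matrix_props[OF p[unfolded *]]
  have X: "transpose X = X"
    using \<xi> * by (simp add: Tan_def sym_mats_def)
  have "x \<bullet> (D *v x) = 0"
    using zero[of "(0, x)"] \<beta> * by (simp add: Xi_metric_def Tan_def sym_mats_def transpose_def vec_eq_iff trace_def)
  then have x: "x = 0"
    using p * by (force simp: Xi_def pos_def_mats_def)
  have tr: "1/2 * trace (?P ** X ** ?P ** Z) + \<alpha> * trace (?P ** X) * trace (?P ** Z) = 0"
    if "transpose Z = Z" for Z
    using zero[of "(Z, 0)"] * that by (simp add: Xi_metric_def Tan_def sym_mats_def)
  have "(1 + 2 * real CARD('n) * \<alpha>) * trace (?P ** X) = 0"
    using tr[OF D(2)] D(1) by (simp add: matrix_inv_invertible trace_I algebra_simps)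
  moreover have "1 + 2 * real CARD('n) * \<alpha> \<noteq> 0"
    using \<alpha> by (auto simp: field_simps)
  ultimately have "trace (?P ** X) = 0"
    by simp
  then have "trace (?P ** X ** ?P ** transpose (?P ** X ** ?P)) = 0"
    using tr[of "?P ** X ** ?P"] D(3) X by (simp add: matrix_transpose_mul matrix_mul_assoc)
  then have "?P ** X ** ?P = 0"
    by (rule trace_mult_transpose_eq_0)
  then have "D ** (?P ** X ** ?P) ** D = 0"
    by simp
  then have "X = 0"
    using D(1) by (simp add: matrix_mul_assoc matrix_inv_invertible)
  with x * show ?thesis by (simp add: zero_prod_def)
qed

text \<open>
  The right-hand side is the derivative of the metric in direction \<open>(X, x)\<close> on constant fields, so
  this is metric compatibility with the derivatives of the fields left out. Both summands on the
  left are evaluated with cyclic invariance of the trace; the terms in which \<open>c\<close> occurs collect to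
  \<open>(1 + 2 n \<alpha>) c - \<alpha> \<beta>\<close>, which is \<open>0\<close>.
\<close>
lemma Xi_metric_christoffel:
  fixes \<alpha> \<beta> c :: real and D X Y Z :: "real^'n^'n" and u x y z :: "real^'n"
  assumes c: "(1 + 2 * real CARD('n) * \<alpha>) * c = \<alpha> * \<beta>"
    and D: "(D, u) \<in> Xi" and X: "(X, x) \<in> Tan" and Y: "(Y, y) \<in> Tan" and Z: "(Z, z) \<in> Tan"
  defines "P \<equiv> matrix_inv D"
  shows "Xi_metric \<alpha> \<beta> (D, u) (Xi_christoffel \<beta> c (D, u) (X, x) (Y, y)) (Z, z)
     + Xi_metric \<alpha> \<beta> (D, u) (Y, y) (Xi_christoffel \<beta> c (D, u) (X, x) (Z, z)) =
     - (1/2) * (trace (P ** X ** P ** Y ** P ** Z) + trace (P ** Y ** P ** X ** P ** Z))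
     - \<alpha> * (trace (P ** X ** P ** Y) * trace (P ** Z) + trace (P ** Y) * trace (P ** X ** P ** Z))
     + \<beta> * (y \<bullet> (X *v z))"
proof -
  note DD = Xi_matrix_props[OF D]
  note sym = X[unfolded Tan_def sym_mats_def, simplified] Y[unfolded Tan_def sym_mats_def, simplified]
    Z[unfolded Tan_def sym_mats_def, simplified]
  have PD: "P ** D = mat 1" "D ** P = mat 1" "A ** P ** D = A" "A ** D ** P = A" for A :: "real^'n^'n"
    using DD(1) by (simp_all add: P_def matrix_inv_invertible)
  have Pv: "P *v (D *v w) = w" "D *v (P *v w) = w" for w
    using DD(1) by (simp_all add: P_def)
  \<comment> \<open>The symmetric product in the Christoffel map is congruent via \<open>P\<close> to \<open>v \<odot> w\<close>, hence represents the
    form \<open>2 * (v \<bullet> (A *v w))\<close> in the trace metric.\<close>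
  have t1: "trace (P ** ((D *v v) \<odot> (D *v w)) ** P ** A) = 2 * (v \<bullet> (A *v w))"
    if "transpose A = A" for v w A
  proof -
    have "P ** ((D *v v) \<odot> (D *v w)) ** P = v \<odot> w"
      using sym_prod_congruence[of P "D *v v" "D *v w"] DD(3) by (simp add: Pv flip: P_def)
    then show ?thesis
      using inner_symmetric_matrix[OF that, of v w] by (simp add: trace_sym_prod_mult inner_commute)
  qed
  have t2: "trace (P ** ((D *v v) \<odot> (D *v w))) = 2 * (v \<bullet> (D *v w))" for v w
    using t1[OF DD(2), of v w] by (simp add: PD)
  have c1: "trace (P ** Y ** P ** Z ** P ** X) = trace (P ** X ** P ** Y ** P ** Z)"
    using trace_mul_sym[of "P ** Y ** P ** Z" "P ** X"] by (simp add: matrix_mul_assoc)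
  have c2: "trace (P ** Y ** P ** ((D *v x) \<odot> (D *v z))) = 2 * (x \<bullet> (Y *v z))"
    using trace_mul_sym[of "P ** Y" "P ** ((D *v x) \<odot> (D *v z))"] t1[of Y x z] sym
    by (simp add: matrix_mul_assoc)
  have c3: "trace (P ** Y ** P ** X) = trace (P ** X ** P ** Y)"
     "trace (P ** Z ** P ** X) = trace (P ** X ** P ** Z)"
    using trace_mul_sym[of "P ** Y" "P ** X"] trace_mul_sym[of "P ** Z" "P ** X"]
    by (simp_all add: matrix_mul_assoc)
  have v1: "v \<bullet> (D *v (P *v w)) = v \<bullet> w" "(P *v v) \<bullet> (D *v w) = v \<bullet> w" for v w
    using inner_symmetric_matrix[OF DD(2), of "P *v v" w] by (simp_all add: Pv)
  have v2: "(X *v v) \<bullet> w = v \<bullet> (X *v w)" "(Y *v v) \<bullet> w = v \<bullet> (Y *v w)"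
      "(Z *v v) \<bullet> w = v \<bullet> (Z *v w)" for v w
    using sym by (simp_all add: inner_symmetric_matrix)
  have v3: "z \<bullet> (X *v y) = y \<bullet> (X *v z)" "y \<bullet> (Z *v x) = x \<bullet> (Z *v y)"
    using v2 by (metis inner_commute)+
  have L: "Xi_metric \<alpha> \<beta> (D, u) (Xi_christoffel \<beta> c (D, u) (X, x) (Y, y)) (Z, z) =
     - (1/4) * (trace (P ** X ** P ** Y ** P ** Z) + trace (P ** Y ** P ** X ** P ** Z))
     - \<alpha> * trace (P ** X ** P ** Y) * trace (P ** Z)
     + ((1 + 2 * real CARD('n) * \<alpha>) * c - \<alpha> * \<beta>) * (x \<bullet> (D *v y)) * trace (P ** Z)
     - \<beta> / 2 * (x \<bullet> (Z *v y)) + \<beta> / 2 * (y \<bullet> (X *v z) + x \<bullet> (Y *v z))"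
    unfolding Xi_metric_def Xi_christoffel_def
    by (simp flip: P_def add: matmul.add_left matmul.add_right matmul.diff_left matmul.diff_right matmul.scaleR_left matmul.scaleR_right
        matmul.minus_left matmul.minus_right trace_add trace_sub trace_minus trace_scaleR PD v1 v2 t1 t2 sym c3 trace_I
        matrix_mul_assoc inner_add_left) (simp add: field_simps)
  have R: "Xi_metric \<alpha> \<beta> (D, u) (Y, y) (Xi_christoffel \<beta> c (D, u) (X, x) (Z, z)) =
     - (1/4) * (trace (P ** Y ** P ** X ** P ** Z) + trace (P ** X ** P ** Y ** P ** Z))
     - \<alpha> * trace (P ** Y) * trace (P ** X ** P ** Z)
     + ((1 + 2 * real CARD('n) * \<alpha>) * c - \<alpha> * \<beta>) * (x \<bullet> (D *v z)) * trace (P ** Y)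
     - \<beta> / 2 * (x \<bullet> (Y *v z)) + \<beta> / 2 * (y \<bullet> (X *v z) + x \<bullet> (Z *v y))"
    unfolding Xi_metric_def Xi_christoffel_def
    by (simp flip: P_def add: matmul.add_left matmul.add_right matmul.diff_left matmul.diff_right matmul.scaleR_left matmul.scaleR_right
        matmul.minus_left matmul.minus_right trace_add trace_sub trace_minus trace_scaleR PD v1 v2 v3 c1 c2 t1 t2 sym c3 trace_I
        matrix_mul_assoc matvec.add_right matvec.scaleR_right inner_add_right) (simp add: field_simps)
  show ?thesis
    unfolding L R c by (simp add: algebra_simps)
qed

section \<open>The Levi-Civita connection of the metric\<close>

lemmas matrix_derivative_intros = has_vector_derivative_const has_vector_derivative_add
  has_vector_derivative_diff has_vector_derivative_minus
  matmul.has_vector_derivative matvec.has_vector_derivative symprod.has_vector_derivative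
  bounded_linear.has_vector_derivative[OF bounded_linear_trace]
  bounded_bilinear.has_vector_derivative[OF bounded_bilinear_inner]
  bounded_bilinear.has_vector_derivative[OF bounded_bilinear_scaleR]
  has_vector_derivative_mult has_vector_derivative_Pair

lemma affine_line_has_vector_derivative:
  "((\<lambda>t. a + t *\<^sub>R b) has_vector_derivative b) (at 0)"
  by (auto intro!: derivative_eq_intros)

lemma Xi_metric_product_rule:
  fixes D X :: "real^'n^'n" and u x :: "real^'n"
  assumes D: "(D, u) \<in> Xi"
    and \<eta>: "(\<eta> has_vector_derivative \<eta>') (at 0)" and \<zeta>: "(\<zeta> has_vector_derivative \<zeta>') (at 0)"
    and Y: "\<eta> 0 = (Y, y)" and Z: "\<zeta> 0 = (Z, z)"
  defines "P \<equiv> matrix_inv D"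
  shows "((\<lambda>t. Xi_metric \<alpha> \<beta> ((D, u) + t *\<^sub>R (X, x)) (\<eta> t) (\<zeta> t)) has_vector_derivative
     Xi_metric \<alpha> \<beta> (D, u) \<eta>' (Z, z) + Xi_metric \<alpha> \<beta> (D, u) (Y, y) \<zeta>'
     - (1/2) * (trace (P ** X ** P ** Y ** P ** Z) + trace (P ** Y ** P ** X ** P ** Z))
     - \<alpha> * (trace (P ** X ** P ** Y) * trace (P ** Z) + trace (P ** Y) * trace (P ** X ** P ** Z))
     + \<beta> * (y \<bullet> (X *v z))) (at 0)"
proof -
  note parts = bounded_linear.has_vector_derivative[OF bounded_linear_fst \<eta>]
    bounded_linear.has_vector_derivative[OF bounded_linear_snd \<eta>]
    bounded_linear.has_vector_derivative[OF bounded_linear_fst \<zeta>]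
    bounded_linear.has_vector_derivative[OF bounded_linear_snd \<zeta>]
  note P' = matrix_inv_has_vector_derivative[OF Xi_matrix_props(1)[OF D], of X]
  note D' = affine_line_has_vector_derivative[of D X]
  show ?thesis
    unfolding Xi_metric_def case_prod_unfold fst_add snd_add fst_scaleR snd_scaleR fst_conv snd_conv
    by (rule has_vector_derivative_eq_rhs, (rule P' D' parts matrix_derivative_intros)+)
      (simp add: Y Z matmul.add_left matmul.add_right matmul.diff_left matmul.diff_right matmul.minus_left matmul.minus_right
        matvec.add_left matvec.add_right inner_add_right trace_add trace_sub trace_minus field_simps
        matrix_mul_assoc flip: P_def)
qed

lemma symmetric_bilinear_on_Xi_christoffel:
  assumes p: "p \<in> Xi"
  shows "symmetric_bilinear_on Tan (Xi_christoffel \<beta> c p)"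
proof -
  obtain D u where *: "p = (D, u)"
    by (metis surj_pair)
  note D = Xi_matrix_props[OF p[unfolded *]]
  have comm: "Xi_christoffel \<beta> c p \<xi> \<eta> = Xi_christoffel \<beta> c p \<eta> \<xi>" for \<xi> \<eta>
    using inner_symmetric_matrix[OF D(2), of "snd \<xi>" "snd \<eta>"]
    by (simp add: Xi_christoffel_def * case_prod_unfold add.commute inner_commute
        sym_prod_commute[of "D *v snd \<xi>"])
  have add: "Xi_christoffel \<beta> c p (\<xi> + \<xi>') \<eta> = Xi_christoffel \<beta> c p \<xi> \<eta> + Xi_christoffel \<beta> c p \<xi>' \<eta>" for \<xi> \<xi>' \<eta>
    by (simp add: Xi_christoffel_def case_prod_unfold prod_eq_iff matmul.add_left matmul.add_right
        matvec.add_left matvec.add_right symprod.add_left inner_add_left algebra_simps)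
  have scale: "Xi_christoffel \<beta> c p (r *\<^sub>R \<xi>) \<eta> = r *\<^sub>R Xi_christoffel \<beta> c p \<xi> \<eta>" for r \<xi> \<eta>
    by (simp add: Xi_christoffel_def case_prod_unfold prod_eq_iff matmul.scaleR_left matmul.scaleR_right
        matvec.scaleR_left matvec.scaleR_right symprod.scaleR_left algebra_simps)
  show ?thesis
    unfolding symmetric_bilinear_on_def
    using p by (auto intro: Xi_christoffel_in_Tan comm add scale)
qed

lemma is_levi_civita_Xi_christoffel:
  fixes \<alpha> \<beta> c :: real
  assumes c: "(1 + 2 * real CARD('n) * \<alpha>) * c = \<alpha> * \<beta>"
  shows "is_levi_civita Tan (Xi :: ((real^'n^'n) \<times> (real^'n)) set) (Xi_metric \<alpha> \<beta>) (Xi_christoffel \<beta> c)"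
  unfolding is_levi_civita_def
proof (intro conjI ballI)
  fix p :: "(real^'n^'n) \<times> (real^'n)"
  assume p: "p \<in> Xi"
  then show bil: "symmetric_bilinear_on Tan (Xi_christoffel \<beta> c p)"
    by (rule symmetric_bilinear_on_Xi_christoffel)
  fix \<xi> \<eta> :: "(real^'n^'n) \<times> (real^'n) \<Rightarrow> (real^'n^'n) \<times> (real^'n)"
  assume \<xi>: "\<xi> \<in> vector_fields Tan Xi" and \<eta>: "\<eta> \<in> vector_fields Tan Xi"
  have T: "\<xi> p \<in> Tan" "\<eta> p \<in> Tan"
    using \<xi> \<eta> p by (auto simp: vector_fields_def)
  show "covariant_deriv (Xi_christoffel \<beta> c) \<xi> \<eta> p - covariant_deriv (Xi_christoffel \<beta> c) \<eta> \<xi> p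
      = lie_bracket \<xi> \<eta> p"
    using bil T by (auto simp: symmetric_bilinear_on_def covariant_deriv_def lie_bracket_def)
  fix \<zeta> :: "(real^'n^'n) \<times> (real^'n) \<Rightarrow> (real^'n^'n) \<times> (real^'n)"
  assume \<zeta>: "\<zeta> \<in> vector_fields Tan Xi"
  have T': "\<zeta> p \<in> Tan"
    using \<zeta> p by (auto simp: vector_fields_def)
  obtain D u X x Y y Z z where *: "p = (D, u)" "\<xi> p = (X, x)" "\<eta> p = (Y, y)" "\<zeta> p = (Z, z)"
    by (metis surj_pair)
  have line: "((\<lambda>t. \<theta> ((D, u) + t *\<^sub>R (X, x))) has_vector_derivative dir_deriv \<theta> p (\<xi> p)) (at 0)"
    if "\<theta> \<in> vector_fields Tan Xi" for \<theta> :: "(real^'n^'n) \<times> (real^'n) \<Rightarrow> (real^'n^'n) \<times> (real^'n)"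
    using has_vector_derivative_along_line[OF _ p eventually_Xi[OF p T(1)], of \<theta>] that *
    by (simp add: vector_fields_def)
  have at0: "\<theta> ((D, u) + 0 *\<^sub>R (X, x)) = \<theta> p" for \<theta> :: "(real^'n^'n) \<times> (real^'n) \<Rightarrow> (real^'n^'n) \<times> (real^'n)"
    using * by simp
  have D: "(D, u) \<in> Xi"
    using p * by simp
  note deriv = Xi_metric_product_rule[OF D line[OF \<eta>] line[OF \<zeta>],
      unfolded at0, OF *(3) *(4), of \<alpha> \<beta> X x]
  have "dir_deriv (\<lambda>q. Xi_metric \<alpha> \<beta> q (\<eta> q) (\<zeta> q)) p (\<xi> p) =
    Xi_metric \<alpha> \<beta> p (dir_deriv \<eta> p (\<xi> p)) (\<zeta> p) + Xi_metric \<alpha> \<beta> p (\<eta> p) (dir_deriv \<zeta> p (\<xi> p))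
    + (Xi_metric \<alpha> \<beta> p (Xi_christoffel \<beta> c p (\<xi> p) (\<eta> p)) (\<zeta> p)
       + Xi_metric \<alpha> \<beta> p (\<eta> p) (Xi_christoffel \<beta> c p (\<xi> p) (\<zeta> p)))"
    unfolding Xi_metric_christoffel[OF c D T(1)[unfolded *(2)] T(2)[unfolded *(3)] T'[unfolded *(4)], folded *]
    by (intro dir_deriv_eqI has_vector_derivative_eq_rhs[OF deriv[folded *]]) simp
  then show "dir_deriv (\<lambda>q. Xi_metric \<alpha> \<beta> q (\<eta> q) (\<zeta> q)) p (\<xi> p) =
     Xi_metric \<alpha> \<beta> p (covariant_deriv (Xi_christoffel \<beta> c) \<xi> \<eta> p) (\<zeta> p) +
     Xi_metric \<alpha> \<beta> p (\<eta> p) (covariant_deriv (Xi_christoffel \<beta> c) \<xi> \<zeta> p)"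
    by (simp add: covariant_deriv_def Xi_metric_add_left Xi_metric_commute[OF p, of \<alpha> \<beta> "\<eta> p"])
qed

text \<open>
  The assumptions on \<open>\<alpha>\<close> and \<open>\<beta>\<close> enter through nondegeneracy, which makes the definite description
  in \<open>levi_civita\<close> denote the closed formula.
\<close>
lemma levi_civita_Xi:
  fixes \<alpha> \<beta> c :: real and p \<xi> \<eta> :: "(real^'n^'n) \<times> (real^'n)"
  assumes \<alpha>: "\<alpha> \<noteq> - 1 / (2 * real CARD('n))" and \<beta>: "\<beta> \<noteq> 0"
    and c: "(1 + 2 * real CARD('n) * \<alpha>) * c = \<alpha> * \<beta>"
    and "p \<in> Xi" "\<xi> \<in> Tan" "\<eta> \<in> Tan"
  shows "levi_civita Tan Xi (Xi_metric \<alpha> \<beta>) p \<xi> \<eta> = Xi_christoffel \<beta> c p \<xi> \<eta>"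
proof (rule levi_civita_eqI[OF is_levi_civita_Xi_christoffel[OF c] subspace_Tan])
  fix p v w :: "(real^'n^'n) \<times> (real^'n)"
  assume p: "p \<in> Xi" and vw: "v \<in> Tan" "w \<in> Tan"
    and eq: "\<And>\<zeta>. \<zeta> \<in> Tan \<Longrightarrow> Xi_metric \<alpha> \<beta> p v \<zeta> = Xi_metric \<alpha> \<beta> p w \<zeta>"
  have "v - w = 0"
    using subspace_diff[OF subspace_Tan vw] eq
    by (intro Xi_metric_nondegenerate[OF \<alpha> \<beta> p]) (simp_all add: Xi_metric_diff_left)
  then show "v = w" by simp
qed (use assms Xi_metric_commute in auto)

section \<open>Curvature\<close>

lemma Xi_christoffel_has_vector_derivative:
  fixes D X Y Z :: "real^'n^'n" and u x y z :: "real^'n"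
  assumes D: "(D, u) \<in> Xi"
  defines "P \<equiv> matrix_inv D"
  shows "((\<lambda>t. Xi_christoffel \<beta> c ((D, u) + t *\<^sub>R (X, x)) (Y, y) (Z, z)) has_vector_derivative
    ((1/2) *\<^sub>R (Y ** P ** X ** P ** Z + Z ** P ** X ** P ** Y)
     - (\<beta>/2) *\<^sub>R ((X *v y) \<odot> (D *v z) + (D *v y) \<odot> (X *v z))
     + (2 * c * (y \<bullet> (X *v z))) *\<^sub>R D + (2 * c * (y \<bullet> (D *v z))) *\<^sub>R X,
     - (1/2) *\<^sub>R ((P ** X ** P) *v (Y *v z + Z *v y)))) (at 0)"
proof -
  note P' = matrix_inv_has_vector_derivative[OF Xi_matrix_props(1)[OF D], of X]
  note D' = affine_line_has_vector_derivative[of D X]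
  show ?thesis
    unfolding Xi_christoffel_def case_prod_unfold fst_add snd_add fst_scaleR snd_scaleR fst_conv snd_conv
    by (rule has_vector_derivative_eq_rhs, (rule P' D' matrix_derivative_intros)+)
      (simp add: matmul.add_left matmul.add_right matmul.minus_left matmul.minus_right matvec.add_left matvec.add_right
        matvec.minus_left scaleR_add_right scaleR_diff_right matrix_mul_assoc flip: P_def)
qed

text \<open>
  With the connection and its derivative in closed form, both components are noncommutative
  polynomials in \<open>X\<close>, \<open>Y\<close>, \<open>Z\<close>, \<open>D\<close> and its inverse \<open>P\<close>, applied to vectors. The terms of order \<open>\<beta>\<close> in the matrix
  component are reduced to symmetric products of vectors by the derivation rule; after that the
  two sides agree term by term.
\<close>
theorem theorem5p1:
  fixes \<alpha> \<beta> :: real and D X Y Z :: "real^'n^'n" and u x y z :: "real^'n"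
  assumes "\<alpha> \<noteq> - 1 / (2 * real CARD('n))" and "\<beta> \<noteq> 0"
    and "(D, u) \<in> Xi" and "(X, x) \<in> Tan" and "(Y, y) \<in> Tan" and "(Z, z) \<in> Tan"
  shows "riemann_curvature Tan Xi (Xi_metric \<alpha> \<beta>) (D, u) (X, x) (Y, y) (Z, z) =
    ((1/4) *\<^sub>R (Z ** matrix_inv D ** X ** matrix_inv D ** Y
               + Y ** matrix_inv D ** X ** matrix_inv D ** Z
               - X ** matrix_inv D ** Y ** matrix_inv D ** Z
               - Z ** matrix_inv D ** Y ** matrix_inv D ** X)
     + (\<beta>/4) *\<^sub>R ((Y *v x) \<odot> (D *v z) - (X *v y) \<odot> (D *v z)
                 + (D *v y) \<odot> (Z *v x) - (D *v x) \<odot> (Z *v y))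
     + (\<alpha> * \<beta> / (1 + 2 * real CARD('n) * \<alpha>)
         * ((X *v y - Y *v x) \<bullet> z + x \<bullet> (Z *v y) - y \<bullet> (Z *v x))) *\<^sub>R D,
     (1/4) *\<^sub>R ((matrix_inv D ** (Y ** matrix_inv D ** X - X ** matrix_inv D ** Y)) *v z
               + (matrix_inv D ** Z ** matrix_inv D) *v (X *v y - Y *v x))
     + (\<beta>/4) *\<^sub>R ((z \<odot> x) *v (D *v y) - (z \<odot> y) *v (D *v x))
     + (\<alpha> * \<beta> / (1 + 2 * real CARD('n) * \<alpha>))
         *\<^sub>R ((y \<bullet> (D *v z)) *\<^sub>R x - (x \<bullet> (D *v z)) *\<^sub>R y))"
proof -
  define c where "c = \<alpha> * \<beta> / (1 + 2 * real CARD('n) * \<alpha>)"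
  define P where "P = matrix_inv D"
  let ?\<Gamma> = "Xi_christoffel \<beta> c"
  have "1 + 2 * real CARD('n) * \<alpha> \<noteq> 0"
    using assms(1) by (auto simp: field_simps)
  then have c: "(1 + 2 * real CARD('n) * \<alpha>) * c = \<alpha> * \<beta>"
    by (simp add: c_def)
  note LC = levi_civita_Xi[OF assms(1,2) c]
  \<comment> \<open>The connection agrees with the closed formula only inside \<open>Xi\<close>; openness along lines makes the
    two agree near \<open>p\<close>, which is what differentiation needs.\<close>
  have deriv: "dir_deriv (\<lambda>q. levi_civita Tan Xi (Xi_metric \<alpha> \<beta>) q \<eta> \<zeta>) p \<xi> = dir_deriv (\<lambda>q. ?\<Gamma> q \<eta> \<zeta>) p \<xi>"
    if "p \<in> Xi" "\<xi> \<in> Tan" "\<eta> \<in> Tan" "\<zeta> \<in> Tan" for p \<xi> \<eta> \<zeta> :: "(real^'n^'n) \<times> (real^'n)"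
  proof -
    have "\<forall>\<^sub>F t in nhds 0. levi_civita Tan Xi (Xi_metric \<alpha> \<beta>) (p + t *\<^sub>R \<xi>) \<eta> \<zeta> = ?\<Gamma> (p + t *\<^sub>R \<xi>) \<eta> \<zeta>"
      using eventually_Xi[OF that(1,2)] by (rule eventually_mono) (rule LC[OF _ that(3,4)])
    then show ?thesis
      unfolding dir_deriv_def by (intro vector_derivative_cong_eq) auto
  qed
  have \<Gamma>': "dir_deriv (\<lambda>q. ?\<Gamma> q (B, b) (C, c')) (D, u) (A, a) =
    ((1/2) *\<^sub>R (B ** P ** A ** P ** C + C ** P ** A ** P ** B)
     - (\<beta>/2) *\<^sub>R ((A *v b) \<odot> (D *v c') + (D *v b) \<odot> (A *v c'))
     + (2 * c * (b \<bullet> (A *v c'))) *\<^sub>R D + (2 * c * (b \<bullet> (D *v c'))) *\<^sub>R A,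
     - (1/2) *\<^sub>R ((P ** A ** P) *v (B *v c' + C *v b)))" for A B C a b c'
    unfolding P_def by (rule dir_deriv_eqI, rule Xi_christoffel_has_vector_derivative[OF assms(3)])
  have R: "riemann_curvature Tan Xi (Xi_metric \<alpha> \<beta>) (D, u) (X, x) (Y, y) (Z, z) =
      dir_deriv (\<lambda>q. ?\<Gamma> q (Y, y) (Z, z)) (D, u) (X, x) - dir_deriv (\<lambda>q. ?\<Gamma> q (X, x) (Z, z)) (D, u) (Y, y)
      + ?\<Gamma> (D, u) (X, x) (?\<Gamma> (D, u) (Y, y) (Z, z)) - ?\<Gamma> (D, u) (Y, y) (?\<Gamma> (D, u) (X, x) (Z, z))"
    using assms(3-6) by (simp add: riemann_curvature_def Let_def deriv LC Xi_christoffel_in_Tan)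
  note D = Xi_matrix_props[OF assms(3)]
  have sym: "transpose X = X" "transpose Y = Y" "transpose Z = Z"
    using assms by (auto simp: Tan_def sym_mats_def)
  have PD: "P ** D = mat 1" "D ** P = mat 1" "A ** P ** D = A" "A ** D ** P = A" for A :: "real^'n^'n"
    using D(1) by (simp_all add: P_def matrix_inv_invertible)
  have Pv: "P *v (D *v w) = w" "D *v (P *v w) = w" for w
    using D(1) by (simp_all add: P_def)
  \<comment> \<open>The derivation rule, oriented so that products with a symmetric product on the right are
    rewritten; those with it on the left cancel.\<close>
  have sp: "A ** P ** ((D *v v) \<odot> (D *v w)) =
      (A *v v) \<odot> (D *v w) + (D *v v) \<odot> (A *v w) - ((D *v v) \<odot> (D *v w)) ** P ** A"
    if "transpose A = A" for A v w
    using sym_prod_derivation[of "A ** P" "D *v v" "D *v w"] that D(3)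
    by (simp add: matrix_transpose_mul P_def[symmetric] Pv algebra_simps matrix_mul_assoc
        flip: matrix_vector_mul_assoc)
  have comm: "(D *v v) \<bullet> w = v \<bullet> (D *v w)" "(X *v v) \<bullet> w = v \<bullet> (X *v w)"
    "(Y *v v) \<bullet> w = v \<bullet> (Y *v w)" "(Z *v v) \<bullet> w = v \<bullet> (Z *v w)" for v w
    using sym D(2) by (simp_all add: inner_symmetric_matrix)
  show ?thesis
    unfolding R \<Gamma>'
    unfolding Xi_christoffel_def c_def[symmetric]
    by (simp only: prod.case,
      simp flip: P_def matrix_vector_mul_assoc add: matrix_mul_assoc matmul.add_left matmul.add_right
        matmul.diff_left matmul.diff_right matmul.scaleR_left matmul.scaleR_right
        matmul.minus_left matmul.minus_right matvec.add_left matvec.add_right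
        matvec.diff_left matvec.diff_right matvec.scaleR_left matvec.scaleR_right
        matvec.minus_left matvec.minus_right symprod.add_left symprod.add_right
        symprod.diff_left symprod.diff_right symprod.scaleR_left symprod.scaleR_right
        symprod.minus_left symprod.minus_right PD Pv sp sym sym_prod_mult_vector
        inner_add_left inner_add_right inner_diff_left inner_diff_right comm,
      simp_all add: vec_eq_iff algebra_simps)
qed

end
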